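(* For all integers $k\ge 2$ and $n\ge 1$, $$\mathrm{op}_{n,k}(321)=P_k(n)\,2^n+(-1)^{k-1}k,$$ where, for fixed $k\ge2$, $P_k(n)$ is the polynomial in $n$ of degree $2k-4$ given by $$P_k(n)=\sum_{i=0}^{k-2}\frac{(n+1)_{2i}}{i!^2}\sum_{j=i}^{k-2}(-1)^{k-j}2^{-2j}\binom{k}{j+2}\frac{2j-2i+1}{j+1}\binom{2(j-i)}{j-i}.$$
   Context: An ordered partition of $[n]=\{1,\dots,n\}$ into $k$ blocks is a sequence $\pi=B_1/B_2/\cdots/B_k$ of nonempty pairwise disjoint subsets with union $[n]$. It contains the pattern $321$ if there exist $1\le i_1<i_2<i_3\le k$ and $b_1\in B_{i_1}$, $b_2\in B_{i_2}$, $b_3\in B_{i_3}$ with $b_1>b_2>b_3$; otherwise it avoids $321$. $\mathrm{op}_{n,k}(321)$ is the number of ordered partitions of $[n]$ into $k$ blocks that avoid $321$ (so it is $0$ when $n<k$). $(x)_m=x(x+1)\cdots(x+m-1)$ is the Pochhammer symbol, with $(x)_0=1$. *)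

theory Defs
  imports Complex_Main "HOL-Computational_Algebra.Polynomial"
begin

definition ordered_partition :: "'a set \<Rightarrow> 'a set list \<Rightarrow> bool" where
  "ordered_partition A Bs \<longleftrightarrow>
     {} \<notin> set Bs \<and>
     (\<forall>i<length Bs. \<forall>j<length Bs. i \<noteq> j \<longrightarrow> Bs ! i \<inter> Bs ! j = {}) \<and>
     \<Union>(set Bs) = A"

definition contains_321 :: "nat set list \<Rightarrow> bool" where
  "contains_321 Bs \<longleftrightarrow>
     (\<exists>i1 i2 i3. i1 < i2 \<and> i2 < i3 \<and> i3 < length Bs \<and>
       (\<exists>b1 \<in> Bs ! i1. \<exists>b2 \<in> Bs ! i2. \<exists>b3 \<in> Bs ! i3. b1 > b2 \<and> b2 > b3))"

definition op_321 :: "nat \<Rightarrow> nat \<Rightarrow> nat" where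
  "op_321 n k =
     card {Bs. ordered_partition {1..n} Bs \<and> length Bs = k \<and> \<not> contains_321 Bs}"

lemma finite_ordered_partitions:
  assumes "finite A"
  shows "finite {Bs. ordered_partition A Bs \<and> length Bs = k}"
proof (rule finite_subset)
  show "{Bs. ordered_partition A Bs \<and> length Bs = k} \<subseteq> {Bs. set Bs \<subseteq> Pow A \<and> length Bs = k}"
    by (auto simp: ordered_partition_def)
  show "finite {Bs. set Bs \<subseteq> Pow A \<and> length Bs = k}"
    using assms by (intro finite_lists_length_eq) simp
qed

(* \<open>[:1, 1:]\<close> is the polynomial x + 1, so that \<open>pochhammer [:1, 1:] (2 * i)\<close> is (x + 1)_{2i}. *)
definition P_poly :: "nat \<Rightarrow> real poly" where
  "P_poly k =
     (\<Sum>i=0..k-2. smult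
        (1 / (fact i)\<^sup>2 *
         (\<Sum>j=i..k-2. (-1) ^ (k - j) * (1 / 2 ^ (2 * j)) * real (k choose (j + 2))
            * (real (2 * (j - i) + 1) / real (j + 1)) * real ((2 * (j - i)) choose (j - i))))
        (pochhammer [:1, 1:] (2 * i)))"

lemma poly_pochhammer: "poly (pochhammer p m) x = pochhammer (poly p x) m"
  by (simp add: pochhammer_prod poly_prod)

lemma poly_P_poly:
  "poly (P_poly k) x =
     (\<Sum>i=0..k-2. pochhammer (x + 1) (2 * i) / (fact i)\<^sup>2 *
        (\<Sum>j=i..k-2. (-1) ^ (k - j) * (1 / 2 ^ (2 * j)) * real (k choose (j + 2))
           * (real (2 * (j - i) + 1) / real (j + 1)) * real ((2 * (j - i)) choose (j - i))))"
  by (simp add: P_poly_def poly_sum poly_pochhammer add.commute mult.commute)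

end

theory Submission
  imports
    Defs
    "HOL-Computational_Algebra.Formal_Power_Series"
    "HOL-Library.Infinite_Set"
begin

text \<open>
  Record an ordered partition of \<open>[n]\<close> into \<open>k\<close> blocks as the word whose letter at position \<open>b\<close> is the
  index of the block that contains \<open>b\<close>. Such words are exactly the words of length \<open>n\<close> in which all
  \<open>k\<close> letters occur, and the partition contains the pattern iff the word has a strictly decreasing
  subsequence of length three. Whether it has one depends only on the relative order of the letters, so
  by inclusion-exclusion over the set of letters that occur,
  \<open>op(n,k) = (\<Sum>m\<le>k. (-1)^(k-m) (k choose m) W(m,n))\<close>, where \<open>W(m,n)\<close> counts all words of length \<open>n\<close> over
  \<open>m\<close> letters that avoid such a subsequence. The terms \<open>m = 0\<close> and \<open>m = 1\<close> are \<open>0\<close> and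
  \<open>(-1)^(k-1) k\<close>; everything else goes into the polynomial, so a closed form for \<open>W(j+2,n)\<close> is
  what has to be found.

  Reading a word from left to right, only two letters matter for how it may go on: the maximum \<open>M\<close>
  so far and the largest letter \<open>t\<close> that was preceded by a larger one. The number of continuations of
  length \<open>n\<close> depends only on \<open>a = M - t\<close> and on the number \<open>b\<close> of letters above \<open>M\<close>; let
  \<open>F_a(x) = (\<Sum>b. (\<Sum>n. completions n a b z^n) x^b)\<close>. The recursion for these numbers turns into
  \<open>(1 - 2z + x) F_(a+1) = (1 - z) (x F_(a+2) + F_a)\<close>, a linear recurrence in \<open>a\<close> whose coefficients do
  not depend on \<open>a\<close> and whose last coefficient is \<open>x\<close>. Its solutions that are power series
  in \<open>x\<close> are geometric, because the quantities \<open>F_(a+2) F_a - F_(a+1)^2\<close> are each \<open>x\<close> times the next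
  and hence zero (lemma \<open>completion_fps_geometric\<close>). Together with \<open>(1 - z) (F_0 - x F_1) = 1\<close> this
  yields the quadratic equation \<open>F_0 = 1/(1-x) + z(1-z) F_0^2\<close>.

  With \<open>u = z(1-z)\<close> and \<open>S = 1 - 2u F_0\<close> the equation reads \<open>(1-x) S^2 = (1-2z)^2 - x\<close>. Differentiating
  with respect to \<open>x\<close> gives \<open>(1-x)^2 S F_0' = 1\<close>, hence
  \<open>F_0' = (1-x)^(-3/2) ((1-2z)^2 - x)^(-1/2)\<close> (lemma \<open>deriv_completion_fps\<close>). Both factors expand in
  central binomial coefficients, and the second one contributes the powers \<open>(1-2z)^(-2i-1)\<close>, whose
  coefficients are \<open>(n+2i choose n) 2^n\<close>. Comparing coefficients of \<open>x^j z^n\<close> gives \<open>(j+1) W(j+2,n)\<close>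
  as the convolution that appears in \<open>P_poly\<close>. The degree is read off from the
  summand \<open>i = k-2\<close>, whose coefficient is a single nonzero term.
\<close>

section \<open>Words without a strictly decreasing triple\<close>

text \<open>
  Here \<open>M\<close> and \<open>t\<close> stand for the maximum of an earlier part of the word and for the largest letter
  there that a larger one precedes. A new letter below \<open>t\<close> would complete a decreasing triple; one in
  between becomes the new \<open>t\<close>, and one that is at least \<open>M\<close> becomes the new maximum.
\<close>

fun avoids_from :: "nat \<Rightarrow> nat \<Rightarrow> nat list \<Rightarrow> bool" where
  "avoids_from t M [] = True"
| "avoids_from t M (x # w) = (t \<le> x \<and> (if M \<le> x then avoids_from t x w else avoids_from x M w))"

fun avoids :: "nat list \<Rightarrow> bool" where
  "avoids [] = True"
| "avoids (x # w) = (sorted_wrt (\<lambda>y z. \<not> (x > y \<and> y > z)) w \<and> avoids w)"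

lemma avoids_iff_nth:
  "avoids w \<longleftrightarrow> \<not> (\<exists>p q r. p < q \<and> q < r \<and> r < length w \<and> w ! p > w ! q \<and> w ! q > w ! r)"
proof (induction w)
  case (Cons x w)
  have "(\<exists>p q r. p < q \<and> q < r \<and> r < length (x # w) \<and> (x # w) ! p > (x # w) ! q \<and> (x # w) ! q > (x # w) ! r)
    \<longleftrightarrow> (\<exists>q r. q < r \<and> r < length w \<and> x > w ! q \<and> w ! q > w ! r)
      \<or> (\<exists>p q r. p < q \<and> q < r \<and> r < length w \<and> w ! p > w ! q \<and> w ! q > w ! r)" (is "?L \<longleftrightarrow> ?R")
  proof
    assume ?L
    then obtain p q r where h: "p < q" "q < r" "r < length (x # w)" "(x # w) ! p > (x # w) ! q"
      "(x # w) ! q > (x # w) ! r" by blast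
    then obtain q' r' where qr: "q = Suc q'" "r = Suc r'"
      by (cases q; cases r) auto
    show ?R
    proof (cases p)
      case 0
      then have "q' < r' \<and> r' < length w \<and> x > w ! q' \<and> w ! q' > w ! r'"
        using h by (simp add: qr)
      then show ?thesis by blast
    next
      case (Suc p')
      then have "p' < q' \<and> q' < r' \<and> r' < length w \<and> w ! p' > w ! q' \<and> w ! q' > w ! r'"
        using h by (simp add: qr)
      then show ?thesis by blast
    qed
  next
    assume ?R
    then show ?L
    proof (elim disjE exE conjE)
      fix q r assume "q < r" "r < length w" "x > w ! q" "w ! q > w ! r"
      then show ?L by (intro exI[of _ 0] exI[of _ "Suc q"] exI[of _ "Suc r"]) simp
    next
      fix p q r assume "p < q" "q < r" "r < length w" "w ! p > w ! q" "w ! q > w ! r"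
      then show ?L by (intro exI[of _ "Suc p"] exI[of _ "Suc q"] exI[of _ "Suc r"]) simp
    qed
  qed
  then show ?case
    unfolding avoids.simps sorted_wrt_iff_nth_less Cons.IH by blast
qed simp

text \<open>
  A decreasing triple that uses the earlier part of the word has two letters there, so that its last
  letter is below \<open>t\<close>, or one letter there, which may be taken to be \<open>M\<close>. A letter \<open>x \<ge> M\<close>
  makes the condition for \<open>M\<close> redundant; for \<open>t \<le> x < M\<close> the requirement that all later letters
  are at least \<open>x\<close> subsumes the decreasing triples that start with \<open>x\<close>.
\<close>

lemma avoids_from_iff:
  "t \<le> M \<Longrightarrow> avoids_from t M w \<longleftrightarrow>
     (\<forall>x\<in>set w. t \<le> x) \<and> sorted_wrt (\<lambda>y z. \<not> (M > y \<and> y > z)) w \<and> avoids w"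
proof (induction w arbitrary: t M)
  case (Cons x w)
  show ?case
  proof (cases "M \<le> x")
    case True
    have "sorted_wrt (\<lambda>y z. \<not> (M > y \<and> y > z)) w" if "sorted_wrt (\<lambda>y z. \<not> (x > y \<and> y > z)) w"
      using that by (rule sorted_wrt_mono_rel[rotated]) (use True in auto)
    then show ?thesis using True Cons by auto
  next
    case False
    have "sorted_wrt (\<lambda>y z. \<not> (x > y \<and> y > z)) w" if "\<forall>y\<in>set w. x \<le> y"
      using that by (induction w) auto
    moreover have "\<forall>y\<in>set w. t \<le> y" if "\<forall>y\<in>set w. x \<le> y" "t \<le> x"
      using that le_trans by blast
    ultimately show ?thesis using False Cons.IH[of x M] by (auto simp: not_less)
  qed
qed simp

section \<open>Enumeration from left to right\<close>

text \<open>
  The first sum runs over the letters \<open>M + s\<close> that become the new maximum, the second over the letters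
  \<open>M - s \<ge> t\<close> that become the new \<open>t\<close>; \<open>a\<close> is \<open>M - t\<close> and \<open>b\<close> is the number of letters above \<open>M\<close>.
\<close>

fun completions :: "nat \<Rightarrow> nat \<Rightarrow> nat \<Rightarrow> nat" where
  "completions 0 a b = 1"
| "completions (Suc n) a b =
     (\<Sum>s\<le>b. completions n (a + s) (b - s)) + (\<Sum>s=1..a. completions n s b)"

lemma card_avoids_from:
  assumes "t \<le> M" "M < m"
  shows "card {w. length w = n \<and> set w \<subseteq> {..<m} \<and> avoids_from t M w} = completions n (M - t) (m - 1 - M)"
  using assms
proof (induction n arbitrary: t M)
  case 0
  have "{w. length w = 0 \<and> set w \<subseteq> {..<m} \<and> avoids_from t M w} = {[]}" by auto
  then show ?case by simp
next
  case (Suc n)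
  let ?G = "\<lambda>t M. {w. length w = n \<and> set w \<subseteq> {..<m} \<and> avoids_from t M w}"
  have fin: "finite (?G t M)" for t M
    by (rule finite_subset[OF _ finite_lists_length_eq[of "{..<m}" n]]) auto
  let ?U = "\<lambda>x. (#) x ` ?G t x" and ?L = "\<lambda>x. (#) x ` ?G x M"
  have "{w. length w = Suc n \<and> set w \<subseteq> {..<m} \<and> avoids_from t M w}
      = (\<Union>x\<in>{M..<m}. ?U x) \<union> (\<Union>x\<in>{t..<M}. ?L x)" (is "?S = ?A \<union> ?B")
  proof (rule set_eqI)
    fix w show "w \<in> ?S \<longleftrightarrow> w \<in> ?A \<union> ?B"
      using Suc.prems by (cases w) (auto simp: not_le)
  qed
  moreover have "?A \<inter> ?B = {}" by auto
  moreover have "card ?A = (\<Sum>x\<in>{M..<m}. card (?U x))"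
    by (rule card_UN_disjoint) (use fin in auto)
  moreover have "card ?B = (\<Sum>x\<in>{t..<M}. card (?L x))"
    by (rule card_UN_disjoint) (use fin in auto)
  moreover have "finite ?A" "finite ?B" using fin by auto
  moreover have "card (?U x) = completions n (x - t) (m - 1 - x)" if "x \<in> {M..<m}" for x
    using that Suc by (subst card_image) auto
  moreover have "card (?L x) = completions n (M - x) (m - 1 - M)" if "x \<in> {t..<M}" for x
    using that Suc by (subst card_image) auto
  ultimately have "card ?S = (\<Sum>x\<in>{M..<m}. completions n (x - t) (m - 1 - x))
      + (\<Sum>x\<in>{t..<M}. completions n (M - x) (m - 1 - M))"
    by (simp add: card_Un_disjoint)
  moreover have "(\<Sum>x\<in>{M..<m}. completions n (x - t) (m - 1 - x))
      = (\<Sum>s\<le>m - 1 - M. completions n (M - t + s) (m - 1 - M - s))"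
    by (rule sum.reindex_bij_witness[of _ "\<lambda>s. M + s" "\<lambda>x. x - M"]) (use Suc.prems in \<open>auto simp: algebra_simps\<close>)
  moreover have "(\<Sum>x\<in>{t..<M}. completions n (M - x) (m - 1 - M))
      = (\<Sum>s=1..M - t. completions n s (m - 1 - M))"
    by (rule sum.reindex_bij_witness[of _ "\<lambda>s. M - s" "\<lambda>x. M - x"]) (use Suc.prems in auto)
  ultimately show ?case by simp
qed

definition avoiding_words :: "nat \<Rightarrow> nat set \<Rightarrow> nat list set" where
  "avoiding_words n A = {w. length w = n \<and> set w \<subseteq> A \<and> avoids w}"

lemma finite_avoiding_words: "finite A \<Longrightarrow> finite (avoiding_words n A)"
  unfolding avoiding_words_def
  by (rule finite_subset[OF _ finite_lists_length_eq[of A n]]) auto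

text \<open>
  Before the first letter, the least letter \<open>0\<close> serves both as \<open>t\<close> and as \<open>M\<close>, since neither value
  forbids anything.
\<close>

lemma card_avoiding_words_eq_completions:
  "card (avoiding_words n {..<Suc b}) = completions n 0 b"
proof -
  have "avoids_from 0 0 w \<longleftrightarrow> avoids w" for w
    by (subst avoids_from_iff) (auto intro: sorted_wrt_mono_rel simp: sorted_wrt_iff_nth_less)
  then show ?thesis
    using card_avoids_from[of 0 0 "Suc b" n] by (simp add: avoiding_words_def)
qed

lemma avoids_map:
  assumes "strict_mono_on A f" "set w \<subseteq> A"
  shows "avoids (map f w) \<longleftrightarrow> avoids w"
proof -
  have "map f w ! j < map f w ! i \<longleftrightarrow> w ! j < w ! i" if "i < length w" "j < length w" for i j
    using that assms strict_mono_on_less[OF assms(1)] by (auto simp: subset_iff)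
  then have "(map f w ! p > map f w ! q \<and> map f w ! q > map f w ! r) \<longleftrightarrow> (w ! p > w ! q \<and> w ! q > w ! r)"
    if "p < q" "q < r" "r < length w" for p q r
    using that by (meson less_trans)
  then show ?thesis
    unfolding avoids_iff_nth length_map by blast
qed

lemma card_avoiding_words_eq_lessThan:
  assumes "finite A"
  shows "card (avoiding_words n A) = card (avoiding_words n {..<card A})"
proof -
  obtain h where h: "bij_betw h {..<card A} A" "strict_mono_on {..<card A} h"
    using ex_bij_betw_strict_mono_card[OF assms] by blast
  then have img: "h ` {..<card A} = A" and inj: "inj_on h {..<card A}"
    by (auto simp: bij_betw_def)
  have "map h ` avoiding_words n {..<card A} = avoiding_words n A"
  proof (intro equalityI subsetI)
    fix w assume "w \<in> map h ` avoiding_words n {..<card A}"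
    then obtain v where v: "w = map h v" "length v = n" "set v \<subseteq> {..<card A}" "avoids v"
      by (auto simp: avoiding_words_def)
    moreover have "h ` set v \<subseteq> A" using v(3) img by blast
    ultimately show "w \<in> avoiding_words n A"
      using avoids_map[OF h(2)] by (simp add: avoiding_words_def)
  next
    fix w assume w: "w \<in> avoiding_words n A"
    then have "w \<in> lists (h ` {..<card A})" using img by (auto simp: avoiding_words_def)
    then obtain v where v: "w = map h v" "set v \<subseteq> {..<card A}"
      unfolding lists_image by blast
    then have "v \<in> avoiding_words n {..<card A}"
      using w avoids_map[OF h(2) v(2)] by (simp add: avoiding_words_def)
    then show "w \<in> map h ` avoiding_words n {..<card A}" using v(1) by blast
  qed
  moreover have "inj_on (map h) (avoiding_words n {..<card A})"
    by (rule inj_on_mapI, rule inj_on_subset[OF inj]) (auto simp: avoiding_words_def)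
  ultimately show ?thesis
    by (metis card_image)
qed

section \<open>Inclusion-exclusion over the set of letters\<close>

definition surjective_avoiding_words :: "nat \<Rightarrow> nat set \<Rightarrow> nat list set" where
  "surjective_avoiding_words n A = {w. length w = n \<and> set w = A \<and> avoids w}"

text \<open>
  Sorting the words over each alphabet by the set of letters that occur expresses \<open>?W\<close> as a sum of
  \<open>?e\<close> over subsets; Moebius inversion on the subset lattice recovers \<open>?e\<close>, and \<open>?W\<close> depends only on
  the number of letters.
\<close>

lemma card_surjective_avoiding_words:
  "real (card (surjective_avoiding_words n {..<k}))
    = (\<Sum>m\<le>k. (-1) ^ (k + m) * real (k choose m) * real (card (avoiding_words n {..<m})))"
proof -
  let ?W = "\<lambda>A. real (card (avoiding_words n A))" and ?e = "\<lambda>A. real (card (surjective_avoiding_words n A))"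
  have decomp: "?W A = (\<Sum>B\<in>Pow A. (-1) ^ card B * ((-1) ^ card B * ?e B))" if "finite A" for A
  proof -
    have "avoiding_words n A = (\<Union>B\<in>Pow A. surjective_avoiding_words n B)"
      by (auto simp: avoiding_words_def surjective_avoiding_words_def)
    also have "card \<dots> = (\<Sum>B\<in>Pow A. card (surjective_avoiding_words n B))"
    proof (rule card_UN_disjoint)
      show "\<forall>B\<in>Pow A. finite (surjective_avoiding_words n B)"
      proof
        fix B assume "B \<in> Pow A"
        then have "surjective_avoiding_words n B \<subseteq> avoiding_words n A"
          by (auto simp: avoiding_words_def surjective_avoiding_words_def)
        then show "finite (surjective_avoiding_words n B)"
          using finite_avoiding_words[OF that] finite_subset by blast
      qed
    qed (use that in \<open>auto simp: surjective_avoiding_words_def\<close>)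
    \<comment> \<open>The two signs cancel; they are there to match the symmetric form of the inversion.\<close>
    finally show ?thesis by (simp flip: mult.assoc power_add)
  qed
  have "(-1) ^ k * ?e {..<k} = (\<Sum>B\<in>Pow {..<k}. (-1) ^ card B * ?W B)"
    using inclusion_exclusion_symmetric[of ?W "\<lambda>B. (-1) ^ card B * ?e B" "{..<k}", OF decomp] by simp
  also have "\<dots> = (\<Sum>B\<in>Pow {..<k}. (-1) ^ card B * ?W {..<card B})"
    by (intro sum.cong refl) (metis card_avoiding_words_eq_lessThan finite_lessThan finite_subset PowD)
  also have "\<dots> = (\<Sum>m\<le>k. \<Sum>B | B \<in> Pow {..<k} \<and> card B = m. (-1) ^ card B * ?W {..<card B})"
    by (rule sum.group[symmetric]) (auto simp: subset_eq_atLeast0_lessThan_card dest: card_mono[rotated])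
  also have "\<dots> = (\<Sum>m\<le>k. real (k choose m) * ((-1) ^ m * ?W {..<m}))"
    using n_subsets[of "{..<k}"] by (intro sum.cong refl) simp
  finally have signed: "(-1) ^ k * ?e {..<k} = (\<Sum>m\<le>k. real (k choose m) * ((-1) ^ m * ?W {..<m}))" .
  have "(-1 :: real) ^ k * (-1) ^ k = 1"
    by (simp flip: power_mult_distrib)
  then have "?e {..<k} = (-1) ^ k * ((-1) ^ k * ?e {..<k})"
    by (simp only: mult.assoc[symmetric] mult_1_left)
  then show ?thesis
    unfolding signed by (simp only: sum_distrib_left power_add mult_ac)
qed

section \<open>Ordered partitions as words\<close>

text \<open>Positions in a list start at \<open>0\<close>, the elements of \<open>[n]\<close> at \<open>1\<close>; hence the shift by \<open>Suc\<close>.\<close>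

definition blocks :: "nat \<Rightarrow> nat list \<Rightarrow> nat set list" where
  "blocks k w = map (\<lambda>i. {Suc p |p. p < length w \<and> w ! p = i}) [0..<k]"

lemma length_blocks [simp]: "length (blocks k w) = k"
  by (simp add: blocks_def)

lemma mem_blocks_iff: "i < k \<Longrightarrow> b \<in> blocks k w ! i \<longleftrightarrow> (\<exists>p<length w. b = Suc p \<and> w ! p = i)"
  by (auto simp: blocks_def)

lemma ordered_partition_blocks:
  assumes "set w = {..<k}"
  shows "ordered_partition {1..length w} (blocks k w)"
  unfolding ordered_partition_def
proof (intro conjI allI impI)
  show "{} \<notin> set (blocks k w)"
  proof
    assume "{} \<in> set (blocks k w)"
    then obtain i where "i < k" "blocks k w ! i = {}" by (metis in_set_conv_nth length_blocks)
    moreover obtain p where "p < length w" "w ! p = i"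
      using assms \<open>i < k\<close> by (metis in_set_conv_nth lessThan_iff)
    ultimately show False using mem_blocks_iff by blast
  qed
  show "blocks k w ! i \<inter> blocks k w ! j = {}"
    if "i < length (blocks k w)" "j < length (blocks k w)" "i \<noteq> j" for i j
    using that by (auto simp: mem_blocks_iff)
  show "\<Union> (set (blocks k w)) = {1..length w}"
  proof (intro equalityI subsetI)
    fix b assume "b \<in> \<Union> (set (blocks k w))"
    then show "b \<in> {1..length w}" by (auto simp: blocks_def)
  next
    fix b assume b: "b \<in> {1..length w}"
    then obtain p where p: "b = Suc p" "p < length w" by (cases b) auto
    then have "w ! p < k" using assms nth_mem by blast
    moreover from this have "b \<in> blocks k w ! (w ! p)"
      using p by (simp add: mem_blocks_iff)
    ultimately show "b \<in> \<Union> (set (blocks k w))" by (metis UnionI length_blocks nth_mem)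
  qed
qed

text \<open>
  Passing from words to partitions exchanges positions and values: the decreasing elements
  \<open>b1 > b2 > b3\<close> in blocks of increasing index are, read from \<open>b3\<close> to \<open>b1\<close>, increasing positions that carry
  decreasing letters.
\<close>

lemma contains_321_blocks:
  assumes "set w \<subseteq> {..<k}"
  shows "contains_321 (blocks k w) \<longleftrightarrow> \<not> avoids w"
proof
  assume "contains_321 (blocks k w)"
  then obtain i1 i2 i3 b1 b2 b3 where i: "i1 < i2" "i2 < i3" "i3 < k"
    and b: "b1 \<in> blocks k w ! i1" "b2 \<in> blocks k w ! i2" "b3 \<in> blocks k w ! i3" "b2 < b1" "b3 < b2"
    unfolding contains_321_def by auto
  have "i1 < k" "i2 < k" using i by linarith+
  with i b obtain p1 p2 p3 where "b1 = Suc p1" "b2 = Suc p2" "b3 = Suc p3"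
    and "p1 < length w" "w ! p1 = i1" "w ! p2 = i2" "w ! p3 = i3"
    by (auto simp: mem_blocks_iff)
  with i b have "p3 < p2 \<and> p2 < p1 \<and> p1 < length w \<and> w ! p3 > w ! p2 \<and> w ! p2 > w ! p1"
    by simp
  then show "\<not> avoids w"
    unfolding avoids_iff_nth by blast
next
  assume "\<not> avoids w"
  then obtain p q r where pqr: "p < q" "q < r" "r < length w" "w ! p > w ! q" "w ! q > w ! r"
    unfolding avoids_iff_nth by blast
  then have "w ! p < k" using assms by (metis less_trans lessThan_iff nth_mem subsetD)
  then have "Suc r \<in> blocks k w ! (w ! r)" "Suc q \<in> blocks k w ! (w ! q)" "Suc p \<in> blocks k w ! (w ! p)"
    using pqr by (auto simp: mem_blocks_iff)
  then show "contains_321 (blocks k w)"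
    unfolding contains_321_def length_blocks using pqr \<open>w ! p < k\<close> by (meson Suc_mono)
qed

lemma ex_word_of_ordered_partition:
  assumes part: "ordered_partition {1..n} Bs"
  obtains w where "length w = n" "set w = {..<length Bs}" "blocks (length Bs) w = Bs"
proof -
  have disj: "i = j" if "i < length Bs" "j < length Bs" "b \<in> Bs ! i" "b \<in> Bs ! j" for i j b
    using part that unfolding ordered_partition_def by blast
  have "\<exists>i<length Bs. Suc p \<in> Bs ! i" if "p < n" for p
  proof -
    have "Suc p \<in> \<Union> (set Bs)" using part that by (simp add: ordered_partition_def)
    then show ?thesis by (metis UnionE in_set_conv_nth)
  qed
  then obtain f where f: "\<And>p. p < n \<Longrightarrow> f p < length Bs \<and> Suc p \<in> Bs ! f p"
    by metis
  define w where "w = map f [0..<n]"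
  have mem: "b \<in> Bs ! i \<longleftrightarrow> (\<exists>p<n. b = Suc p \<and> f p = i)" if "i < length Bs" for b i
  proof
    assume b: "b \<in> Bs ! i"
    then have "b \<in> {1..n}" using part that unfolding ordered_partition_def by (metis UnionI nth_mem)
    then obtain p where "b = Suc p" "p < n" by (cases b) auto
    then show "\<exists>p<n. b = Suc p \<and> f p = i" using f disj b that by blast
  qed (use f in blast)
  have "blocks (length Bs) w = Bs"
    by (rule nth_equalityI) (auto simp: w_def mem mem_blocks_iff)
  moreover have "set w = {..<length Bs}"
  proof (intro equalityI subsetI)
    fix i assume i: "i \<in> {..<length Bs}"
    then have "Bs ! i \<noteq> {}" using part unfolding ordered_partition_def by (metis lessThan_iff nth_mem)
    then show "i \<in> set w" using mem i by (auto simp: w_def)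
  qed (use f in \<open>auto simp: w_def\<close>)
  ultimately show ?thesis using that[of w] by (simp add: w_def)
qed

lemma inj_on_blocks: "inj_on (blocks k) {w. length w = n \<and> set w \<subseteq> {..<k}}"
proof (rule inj_onI)
  fix v w assume v: "v \<in> {w. length w = n \<and> set w \<subseteq> {..<k}}" and w: "w \<in> {w. length w = n \<and> set w \<subseteq> {..<k}}"
    and eq: "blocks k v = blocks k w"
  show "v = w"
  proof (rule nth_equalityI)
    fix p assume p: "p < length v"
    have "set v \<subseteq> {..<k}" using v by simp
    then have "v ! p < k" using nth_mem[OF p] by blast
    then have "Suc p \<in> blocks k v ! (v ! p)" using p by (auto simp: mem_blocks_iff)
    then show "v ! p = w ! p" unfolding eq using \<open>v ! p < k\<close> by (simp add: mem_blocks_iff)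
  qed (use v w in auto)
qed

lemma op_321_eq_card_words: "op_321 n k = card (surjective_avoiding_words n {..<k})"
proof -
  have "{Bs. ordered_partition {1..n} Bs \<and> length Bs = k \<and> \<not> contains_321 Bs}
      = blocks k ` surjective_avoiding_words n {..<k}" (is "?P = ?I")
  proof (intro equalityI subsetI)
    fix Bs assume "Bs \<in> ?P"
    then have Bs: "ordered_partition {1..n} Bs" "length Bs = k" "\<not> contains_321 Bs" by auto
    then obtain w where w: "length w = n" "set w = {..<k}" "blocks k w = Bs"
      by (metis ex_word_of_ordered_partition)
    then show "Bs \<in> ?I"
      using Bs contains_321_blocks[of w k] by (auto simp: surjective_avoiding_words_def)
  qed (use ordered_partition_blocks contains_321_blocks in \<open>auto simp: surjective_avoiding_words_def\<close>)
  moreover have "inj_on (blocks k) (surjective_avoiding_words n {..<k})"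
    by (rule inj_on_subset[OF inj_on_blocks[of k n]]) (auto simp: surjective_avoiding_words_def)
  ultimately show ?thesis unfolding op_321_def by (simp add: card_image)
qed

section \<open>Polynomial identities for the generating function\<close>

unbundle fps_syntax

text \<open>
  The computations of the next sections, with the power series replaced by elements of an arbitrary
  integral domain, where \<open>algebra\<close> works on plain variables. In their use, \<open>x\<close> and \<open>z\<close> are the two
  formal variables, \<open>f0\<close>, \<open>f1\<close>, \<open>f2\<close>, \<open>f3\<close> consecutive series \<open>F_a\<close>, and \<open>C\<close> is \<open>F_0\<close>.
\<close>

context
  fixes x z :: "'a::idom"
begin

lemma recurrence_collect:
  assumes "f1 + x * f1 + z * f0 + z * (x * f2) = x * f2 + f0 + (z * f1 + z * f1)"
  shows "(1 - 2 * z + x) * f1 = (1 - z) * (x * f2 + f0)"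
  using assms by algebra

text \<open>
  The expression \<open>f2 * f0 - f1\<^sup>2\<close> is the Casoratian of a solution of a second-order recurrence and its
  shift, so consecutive ones differ by the ratio of the outer coefficients, here \<open>x\<close>.
\<close>

lemma casoratian_step:
  assumes "\<beta> * f1 = v * (x * f2 + f0)" "\<beta> * f2 = v * (x * f3 + f1)"
  shows "v * (f2 * f0 - f1\<^sup>2) = v * (x * (f3 * f1 - f2\<^sup>2))"
  using assms by algebra

lemma quadratic_from_recurrence:
  assumes "(1 - z) * (C - x * f1) = 1"
    and "(1 - 2 * z + x) * f1 = (1 - z) * (x * f2 + C)"
    and "f2 * C = f1\<^sup>2"
  shows "z * (1 - z) * (1 - x) * C\<^sup>2 - (1 - x) * C + 1 = 0"
  using assms by algebra

lemma quadratic_complete_square: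
  assumes "z * (1 - z) * (1 - x) * C\<^sup>2 - (1 - x) * C + 1 = 0"
  shows "(1 - x) * (1 - 2 * (z * (1 - z)) * C)\<^sup>2 = (1 - 2 * z)\<^sup>2 - x"
  using assms by algebra

text \<open>
  The first assumption is the derivative of the second with respect to \<open>x\<close>, where \<open>- 2 * u * D\<close> is
  the derivative of \<open>S\<close>.
\<close>

lemma derivative_from_square:
  assumes "2 * (1 - x) * S * (- 2 * u * D) - S\<^sup>2 = - 1" "(1 - x) * S\<^sup>2 = 1 - 4 * u - x"
  shows "4 * u * ((1 - x)\<^sup>2 * S * D) = 4 * u * 1"
  using assms by algebra

lemma square_of_derivative:
  assumes "(1 - x)\<^sup>2 * S * D = 1"
  shows "(1 - x) ^ 3 * ((1 - x) * S\<^sup>2) * D\<^sup>2 = 1"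
  using assms by algebra

lemma inverse_sqrt_cubed:
  assumes "Q\<^sup>2 * (1 - x) = 1" "(1 - x) * A = Q"
  shows "A\<^sup>2 * (1 - x) ^ 3 = 1"
  using assms by algebra

lemma inverse_unique_square:
  fixes D E p :: 'a
  assumes "p * D\<^sup>2 = 1" "E\<^sup>2 * p = 1"
  shows "D\<^sup>2 = E\<^sup>2"
proof -
  have "D\<^sup>2 = E\<^sup>2 * p * D\<^sup>2" by (simp only: assms(2) mult_1_left)
  also have "\<dots> = E\<^sup>2" by (simp only: mult.assoc assms(1) mult_1_right)
  finally show ?thesis .
qed

lemma square_of_product:
  assumes "t * G = 1" "B\<^sup>2 * (1 - G\<^sup>2 * x) = 1" "A\<^sup>2 * (1 - x) ^ 3 = 1"
  shows "(G * B * A)\<^sup>2 * ((1 - x) ^ 3 * (t\<^sup>2 - x)) = 1"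
  using assms by algebra

end

section \<open>The bivariate generating function\<close>

lemma completions_Suc_b:
  "completions (Suc n) a (Suc b) = completions n a (Suc b)
     + (\<Sum>s\<le>b. completions n (Suc a + s) (b - s)) + (\<Sum>s=1..a. completions n s (Suc b))"
  by (simp add: sum.atMost_Suc_shift del: sum.atMost_Suc)

text \<open>
  Moving along the antidiagonal from \<open>(a, b + 1)\<close> to \<open>(a + 1, b)\<close> removes all but one term of the
  first sum, and increasing \<open>a\<close> then does the same to the second sum. What remains is a recurrence
  with constant coefficients.
\<close>

lemma completions_rec:
  "completions (Suc n) (Suc a) (Suc b) + completions (Suc n) (Suc a) b
      + completions n a (Suc b) + completions n (Suc (Suc a)) b
    = completions (Suc n) (Suc (Suc a)) b + completions (Suc n) a (Suc b)
      + 2 * completions n (Suc a) (Suc b)"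
  by (simp add: completions_Suc_b del: completions.simps(2)) (simp add: completions_Suc_b)

lemma completions_rec_0:
  "completions (Suc n) (Suc a) 0 + completions n a 0
    = completions (Suc n) a 0 + 2 * completions n (Suc a) 0"
  by simp

text \<open>
  Pretending that the second least letter has already been read forbids nothing: only the least
  letter is smaller, and nothing is smaller than that.
\<close>

lemma completions_0_Suc: "completions n 0 (Suc b) = completions n 1 b"
proof (induction n)
  case (Suc n)
  then show ?case by (subst completions_Suc_b) simp
qed simp

lemma completions_0_0: "completions n 0 0 = 1"
  by (induction n) simp_all

text \<open>
  The variable of the outer series, called \<open>x\<close> in comments, marks \<open>b\<close>; that of the inner series,
  called \<open>z\<close>, marks the length.
\<close>

definition completion_fps :: "nat \<Rightarrow> real fps fps" where
  "completion_fps a = Abs_fps (\<lambda>b. Abs_fps (\<lambda>n. real (completions n a b)))"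

lemma completion_fps_nth [simp]: "completion_fps a $ b $ n = real (completions n a b)"
  by (simp add: completion_fps_def)

definition fps_Z :: "real fps fps" where "fps_Z = fps_const fps_X"

lemma fps_Z_mult_nth [simp]: "(fps_Z * f) $ b = fps_X * f $ b"
  by (simp add: fps_Z_def)

lemma fps_double_nth: "(2 * f) $ n = 2 * f $ n" for f :: "'a::comm_ring_1 fps"
  by (simp add: numeral_fps_const)

lemma completion_fps_rec:
  "(1 - 2 * fps_Z + fps_X) * completion_fps (Suc a)
    = (1 - fps_Z) * (fps_X * completion_fps (Suc (Suc a)) + completion_fps a)"
proof -
  let ?F = completion_fps
  have "?F (Suc a) + fps_X * ?F (Suc a) + fps_Z * ?F a + fps_Z * (fps_X * ?F (Suc (Suc a)))
      = fps_X * ?F (Suc (Suc a)) + ?F a + (fps_Z * ?F (Suc a) + fps_Z * ?F (Suc a))"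
  proof (intro fps_ext)
    fix b n
    show "(?F (Suc a) + fps_X * ?F (Suc a) + fps_Z * ?F a + fps_Z * (fps_X * ?F (Suc (Suc a)))) $ b $ n
      = (fps_X * ?F (Suc (Suc a)) + ?F a + (fps_Z * ?F (Suc a) + fps_Z * ?F (Suc a))) $ b $ n"
      using arg_cong[OF completions_rec[of "n - 1" a "b - 1"], of real]
        arg_cong[OF completions_rec_0[of "n - 1" a], of real]
      by (cases b; cases n) (simp_all add: fps_double_nth del: completions.simps(2) fps_mult_nth_0)
  qed
  then show ?thesis by (rule recurrence_collect)
qed

text \<open>
  By \<open>completions_0_Suc\<close> the difference consists of its constant coefficient alone, and that is
  the geometric series \<open>1/(1-z)\<close>.
\<close>

lemma completion_fps_0:
  "(1 - fps_Z) * (completion_fps 0 - fps_X * completion_fps 1) = 1"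
proof -
  have "completion_fps 0 - fps_X * completion_fps 1 = fps_const (Abs_fps (\<lambda>_. 1))"
  proof (intro fps_ext)
    fix b n
    show "(completion_fps 0 - fps_X * completion_fps 1) $ b $ n = fps_const (Abs_fps (\<lambda>_. 1)) $ b $ n"
      by (cases b) (simp_all add: completions_0_0 completions_0_Suc del: completions.simps(2))
  qed
  moreover have "(1 - fps_X) * Abs_fps (\<lambda>_. 1 :: real) = 1"
  proof (rule fps_ext)
    fix n show "((1 - fps_X) * Abs_fps (\<lambda>_. 1 :: real)) $ n = 1 $ n"
      by (cases n) (simp_all add: left_diff_distrib)
  qed
  ultimately show ?thesis
    by (simp add: fps_Z_def flip: fps_const_1_eq_1)
qed

text \<open>Every \<open>e a\<close> is divisible by all powers of the variable.\<close>

lemma fps_eq_X_shift_imp_0: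
  fixes e :: "nat \<Rightarrow> 'a::comm_ring_1 fps"
  assumes "\<And>a. e a = fps_X * e (Suc a)"
  shows "e a = 0"
proof (rule fps_ext)
  fix b
  have "e a $ b = 0"
  proof (induction b arbitrary: a)
    case 0
    have "e a $ 0 = (fps_X * e (Suc a)) $ 0" by (rule arg_cong[OF assms])
    then show ?case by simp
  next
    case (Suc b)
    have "e a $ Suc b = (fps_X * e (Suc a)) $ Suc b" by (rule arg_cong[OF assms])
    then show ?case by (simp add: Suc.IH)
  qed
  then show "e a $ b = 0 $ b" by simp
qed

lemma one_minus_fps_Z_neq_0: "1 - fps_Z \<noteq> 0"
proof
  assume "1 - fps_Z = 0"
  then have "(1 - fps_Z) $ 0 $ 0 = 0 $ 0 $ 0" by (rule arg_cong)
  then show False by (simp add: fps_Z_def)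
qed

lemma completion_fps_geometric:
  "completion_fps (Suc (Suc a)) * completion_fps a = completion_fps (Suc a) ^ 2"
proof -
  let ?F = completion_fps
  let ?E = "\<lambda>a. ?F (Suc (Suc a)) * ?F a - ?F (Suc a) ^ 2"
  have "?E a = fps_X * ?E (Suc a)" for a
  proof -
    have "(1 - fps_Z) * ?E a = (1 - fps_Z) * (fps_X * ?E (Suc a))"
      using completion_fps_rec completion_fps_rec by (rule casoratian_step)
    then show ?thesis by (rule iffD1[OF mult_left_cancel[OF one_minus_fps_Z_neq_0]])
  qed
  then have "?E a = 0" by (rule fps_eq_X_shift_imp_0[of ?E])
  then show ?thesis by (rule iffD1[OF right_minus_eq])
qed

text \<open>
  The cases \<open>a = 0\<close> of the recurrence and of the geometric law, together with the boundary
  equation, eliminate \<open>F_1\<close> and \<open>F_2\<close>.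
\<close>

lemma completion_fps_quadratic:
  "fps_Z * (1 - fps_Z) * (1 - fps_X) * completion_fps 0 ^ 2 - (1 - fps_X) * completion_fps 0 + 1 = 0"
  using completion_fps_0 completion_fps_rec[of 0, folded One_nat_def]
    completion_fps_geometric[of 0, folded One_nat_def]
  by (rule quadratic_from_recurrence)

text \<open>
  Completing the square and differentiating, as opposed to solving the quadratic equation, avoids
  square roots of power series and the division by \<open>u\<close>.
\<close>

lemma deriv_completion_fps_square:
  "(1 - fps_X) ^ 3 * ((1 - 2 * fps_Z)\<^sup>2 - fps_X) * fps_deriv (completion_fps 0) ^ 2 = 1"
proof -
  let ?C = "completion_fps 0" and ?x = "fps_X :: real fps fps"
  define u S C' where "u = fps_Z * (1 - fps_Z)" and "S = 1 - 2 * u * ?C" and "C' = fps_deriv ?C"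
  have sq: "(1 - ?x) * S ^ 2 = (1 - 2 * fps_Z)\<^sup>2 - ?x"
    unfolding S_def u_def using completion_fps_quadratic by (rule quadratic_complete_square)
  have deriv_fps_Z: "fps_deriv fps_Z = 0" by (simp add: fps_Z_def)
  then have deriv_u: "fps_deriv u = 0" by (simp add: u_def)
  have S': "fps_deriv S = - 2 * u * C'"
    using deriv_u by (simp add: S_def C'_def mult_ac)
  have "fps_deriv ((1 - ?x) * S ^ 2) = fps_deriv ((1 - 2 * fps_Z)\<^sup>2 - ?x)"
    by (simp only: sq)
  then have "2 * (1 - ?x) * S * fps_deriv S - S ^ 2 = - 1"
    by (simp add: power2_eq_square deriv_fps_Z algebra_simps)
  moreover have "(1 - 2 * fps_Z)\<^sup>2 = 1 - 4 * u"
    by (simp add: u_def power2_eq_square algebra_simps)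
  ultimately have "4 * u * ((1 - ?x) ^ 2 * S * C') = 4 * u * 1"
    using sq unfolding S' by (intro derivative_from_square) simp_all
  moreover have "u \<noteq> 0" using one_minus_fps_Z_neq_0 by (auto simp: u_def fps_Z_def)
  ultimately have "(1 - ?x) ^ 2 * S * C' = 1"
    unfolding mult_cancel_left by auto
  then show ?thesis
    unfolding C'_def[symmetric] sq[symmetric] by (rule square_of_derivative)
qed

section \<open>Series with half-integer exponents\<close>

text \<open>The coefficients of \<open>(1-x)^(-1/2)\<close>.\<close>

definition inv_sqrt_coeff :: "nat \<Rightarrow> real" where
  "inv_sqrt_coeff i = real ((2 * i) choose i) / 4 ^ i"

lemma inv_sqrt_coeff_Suc:
  "2 * real (Suc i) * inv_sqrt_coeff (Suc i) = real (2 * i + 1) * inv_sqrt_coeff i"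
proof -
  have "(2 * i + 1) choose i = (2 * i + 1) choose Suc i"
    by (subst binomial_symmetric) simp_all
  then have "Suc i * ((2 * i + 1) choose i) = (2 * i + 1) * ((2 * i) choose i)"
    using Suc_times_binomial_eq[of "2 * i" i] by (simp add: mult_ac)
  moreover have "Suc i * ((2 * Suc i) choose Suc i) = 2 * Suc i * ((2 * i + 1) choose i)"
    using Suc_times_binomial_eq[of "2 * i + 1" i] by (simp add: mult_ac)
  ultimately have "Suc i * ((2 * Suc i) choose Suc i) = 2 * ((2 * i + 1) * ((2 * i) choose i))"
    by (simp only: mult.assoc)
  from arg_cong[OF this, of real]
  have "real (Suc i) * real ((2 * Suc i) choose Suc i) = 2 * (real (2 * i + 1) * real ((2 * i) choose i))"
    by (simp only: of_nat_mult of_nat_numeral)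
  then have "2 * real (Suc i) * inv_sqrt_coeff (Suc i) = 2 * (2 * (real (2 * i + 1) * real ((2 * i) choose i))) / 4 ^ Suc i"
    by (simp only: inv_sqrt_coeff_def times_divide_eq_right mult.assoc)
  also have "\<dots> = real (2 * i + 1) * inv_sqrt_coeff i"
    by (simp add: inv_sqrt_coeff_def)
  finally show ?thesis .
qed

text \<open>
  The second series is twice the derivative of the first, \<open>(1-x)^(-1/2)\<close>, and hence is \<open>(1-x)^(-3/2)\<close>.
\<close>

lemma inv_sqrt_series:
  "Abs_fps inv_sqrt_coeff ^ 2 * (1 - fps_X) = 1"
  "Abs_fps (\<lambda>i. real (2 * i + 1) * inv_sqrt_coeff i) ^ 2 * (1 - fps_X) ^ 3 = 1"
proof -
  let ?Q = "Abs_fps inv_sqrt_coeff" and ?A = "Abs_fps (\<lambda>i. real (2 * i + 1) * inv_sqrt_coeff i)"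
  have A: "?A = 2 * fps_deriv ?Q"
  proof (rule fps_ext)
    fix n
    have "(2 * fps_deriv ?Q) $ n = 2 * (real (n + 1) * inv_sqrt_coeff (n + 1))"
      by (simp only: fps_double_nth fps_deriv_nth fps_nth_Abs_fps)
    also have "\<dots> = ?A $ n"
      using inv_sqrt_coeff_Suc[of n] by (simp only: fps_nth_Abs_fps Suc_eq_plus1 mult.assoc)
    finally show "?A $ n = (2 * fps_deriv ?Q) $ n" ..
  qed
  have ODE: "(1 - fps_X) * ?A = ?Q"
  proof (rule fps_ext)
    fix i show "((1 - fps_X) * ?A) $ i = ?Q $ i"
      using inv_sqrt_coeff_Suc[of "i - 1"] by (cases i) (auto simp: algebra_simps)
  qed
  have "fps_deriv (?Q ^ 2 * (1 - fps_X)) = ?Q * (2 * fps_deriv ?Q * (1 - fps_X)) - ?Q ^ 2"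
    by (simp add: power2_eq_square algebra_simps)
  also have "\<dots> = 0" using ODE unfolding A by (simp add: power2_eq_square mult_ac)
  finally have "?Q ^ 2 * (1 - fps_X) = fps_const ((?Q ^ 2 * (1 - fps_X)) $ 0)"
    by (simp only: fps_deriv_eq_0_iff)
  then show Q: "?Q ^ 2 * (1 - fps_X) = 1" by (simp add: inv_sqrt_coeff_def power2_eq_square)
  show "?A ^ 2 * (1 - fps_X) ^ 3 = 1" using Q ODE by (rule inverse_sqrt_cubed)
qed

text \<open>
  The substitution \<open>f(x) \<mapsto> f(h x)\<close> for a series \<open>h\<close> in the inner variable. It is a ring homomorphism
  and thus carries the identities for the two square roots into the bivariate ring.
\<close>

definition fps_dilate :: "real fps \<Rightarrow> real fps \<Rightarrow> real fps fps" where
  "fps_dilate h f = Abs_fps (\<lambda>i. fps_const (f $ i) * h ^ i)"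

lemma fps_const_sum: "fps_const (\<Sum>i\<in>A. f i) = (\<Sum>i\<in>A. fps_const (f i))"
  by (induction A rule: infinite_finite_induct) (simp_all flip: fps_const_add)

lemma fps_dilate_mult: "fps_dilate h (f * g) = fps_dilate h f * fps_dilate h g"
proof (rule fps_ext)
  fix n
  have "(fps_dilate h f * fps_dilate h g) $ n
      = (\<Sum>i=0..n. fps_const (f $ i) * h ^ i * (fps_const (g $ (n - i)) * h ^ (n - i)))"
    by (simp add: fps_dilate_def fps_mult_nth)
  also have "\<dots> = (\<Sum>i=0..n. fps_const (f $ i * g $ (n - i)) * h ^ n)"
    by (intro sum.cong refl) (simp add: mult_ac flip: power_add fps_const_mult)
  also have "\<dots> = fps_dilate h (f * g) $ n"
    by (simp add: fps_dilate_def fps_mult_nth sum_distrib_right fps_const_sum)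
  finally show "fps_dilate h (f * g) $ n = (fps_dilate h f * fps_dilate h g) $ n" ..
qed

lemma fps_dilate_1 [simp]: "fps_dilate h 1 = 1"
  by (rule fps_ext) (simp add: fps_dilate_def)

lemma fps_dilate_power: "fps_dilate h (f ^ n) = fps_dilate h f ^ n"
  by (induction n) (simp_all add: fps_dilate_mult)

lemma fps_dilate_one_minus_X: "fps_dilate h (1 - fps_X) = 1 - fps_const h * fps_X"
  by (rule fps_ext) (auto simp: fps_dilate_def fps_X_def simp flip: fps_const_neg)

text \<open>
  Since \<open>(1-2z)^2 - x = (1-2z)^2 (1 - g^2 x)\<close>, the first two factors together are
  \<open>((1-2z)^2 - x)^(-1/2)\<close>; the third is \<open>(1-x)^(-3/2)\<close>. Both sides have the same square, and their
  constant terms fix the sign.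
\<close>

lemma deriv_completion_fps:
  defines "g \<equiv> inverse (1 - fps_const 2 * fps_X)"
  shows "fps_deriv (completion_fps 0)
    = fps_const g * fps_dilate (g\<^sup>2) (Abs_fps inv_sqrt_coeff)
        * fps_dilate 1 (Abs_fps (\<lambda>i. real (2 * i + 1) * inv_sqrt_coeff i))"
    (is "?D = fps_const g * ?B * ?A")
proof -
  let ?G = "fps_const g"
  have "fps_const ((1 - fps_const 2 * fps_X) * g) = 1"
    unfolding g_def by (subst inverse_mult_eq_1') simp_all
  then have G: "(1 - 2 * fps_Z) * ?G = 1"
    by (simp add: fps_Z_def numeral_fps_const flip: fps_const_1_eq_1)
  have B: "?B ^ 2 * (1 - ?G ^ 2 * fps_X) = 1"
    using arg_cong[OF inv_sqrt_series(1), of "fps_dilate (g\<^sup>2)"]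
    by (simp add: fps_dilate_mult fps_dilate_power fps_dilate_one_minus_X fps_const_power)
  have A: "?A ^ 2 * (1 - fps_X) ^ 3 = 1"
    using arg_cong[OF inv_sqrt_series(2), of "fps_dilate 1"]
    by (simp add: fps_dilate_mult fps_dilate_power fps_dilate_one_minus_X)
  have "(?G * ?B * ?A) ^ 2 * ((1 - fps_X) ^ 3 * ((1 - 2 * fps_Z)\<^sup>2 - fps_X)) = 1"
    using G B A by (rule square_of_product)
  with deriv_completion_fps_square have "?D ^ 2 = (?G * ?B * ?A) ^ 2"
    by (rule inverse_unique_square)
  then have "?D = ?G * ?B * ?A \<or> ?D = - (?G * ?B * ?A)" by (simp only: power2_eq_iff)
  moreover have "?D $ 0 $ 0 = 1" by simp
  moreover have "(?G * ?B * ?A) $ 0 $ 0 = 1" by (simp add: fps_dilate_def inv_sqrt_coeff_def g_def)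
  moreover have "?D \<noteq> - (?G * ?B * ?A)"
  proof
    assume "?D = - (?G * ?B * ?A)"
    then have "?D $ 0 $ 0 = (- (?G * ?B * ?A)) $ 0 $ 0" by (simp only:)
    also have "\<dots> = - ((?G * ?B * ?A) $ 0 $ 0)" by (simp only: fps_neg_nth)
    finally show False
      using \<open>?D $ 0 $ 0 = 1\<close> \<open>(?G * ?B * ?A) $ 0 $ 0 = 1\<close> by simp
  qed
  ultimately show ?thesis by blast
qed

lemma completions_closed_form:
  "real (j + 1) * real (completions n 0 (j + 1))
    = 2 ^ n * (\<Sum>i=0..j. real ((n + 2 * i) choose n) * inv_sqrt_coeff i
        * real (2 * (j - i) + 1) * inv_sqrt_coeff (j - i))"
proof -
  define g where "g = inverse (1 - fps_const 2 * fps_X :: real fps)"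
  have g: "g ^ (2 * i + 1) $ n = real ((n + 2 * i) choose n) * 2 ^ n" for i
    using one_minus_const_fps_X_neg_power'[of "2 * i + 1" "2 :: real"]
    by (simp add: g_def fps_inverse_power add.commute del: power_Suc)
  have B: "(fps_const g * fps_dilate (g\<^sup>2) (Abs_fps inv_sqrt_coeff)) $ i = fps_const (inv_sqrt_coeff i) * g ^ (2 * i + 1)" for i
    by (simp add: fps_dilate_def mult_ac flip: power_mult)
  have A: "fps_dilate 1 (Abs_fps f) $ i = fps_const (f i)" for f :: "nat \<Rightarrow> real" and i
    by (simp add: fps_dilate_def)
  have "real (j + 1) * real (completions n 0 (j + 1)) = fps_deriv (completion_fps 0) $ j $ n"
    by (simp only: fps_deriv_nth fps_of_nat[symmetric] fps_mult_left_const_nth completion_fps_nth)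
  also have "fps_deriv (completion_fps 0) $ j
      = (\<Sum>i=0..j. (fps_const g * fps_dilate (g\<^sup>2) (Abs_fps inv_sqrt_coeff)) $ i
        * fps_dilate 1 (Abs_fps (\<lambda>i. real (2 * i + 1) * inv_sqrt_coeff i)) $ (j - i))"
    unfolding deriv_completion_fps g_def[symmetric] by (rule fps_mult_nth)
  also have "\<dots> = (\<Sum>i=0..j. fps_const (inv_sqrt_coeff i * (real (2 * (j - i) + 1) * inv_sqrt_coeff (j - i))) * g ^ (2 * i + 1))"
    by (intro sum.cong refl) (simp only: A B fps_const_mult[symmetric] mult_ac)
  also have "\<dots> $ n = (\<Sum>i=0..j. inv_sqrt_coeff i * (real (2 * (j - i) + 1) * inv_sqrt_coeff (j - i))
        * (real ((n + 2 * i) choose n) * 2 ^ n))"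
    by (simp only: fps_sum_nth fps_mult_left_const_nth g)
  also have "\<dots> = 2 ^ n * (\<Sum>i=0..j. real ((n + 2 * i) choose n) * inv_sqrt_coeff i
        * real (2 * (j - i) + 1) * inv_sqrt_coeff (j - i))"
    by (simp only: sum_distrib_left mult_ac)
  finally show ?thesis .
qed

section \<open>The closed form and its degree\<close>

lemma card_avoiding_words_closed_form:
  "real (card (avoiding_words n {..<j + 2}))
    = 2 ^ n * (\<Sum>i=0..j. real ((n + 2 * i) choose n) * inv_sqrt_coeff i
        * real (2 * (j - i) + 1) * inv_sqrt_coeff (j - i)) / real (j + 1)"
  using completions_closed_form[of j n] card_avoiding_words_eq_completions[of n "j + 1"]
  by (simp add: nonzero_eq_divide_eq mult.commute)

lemma pochhammer_div_fact_square:
  "pochhammer (real n + 1) (2 * i) / (fact i)\<^sup>2 = real ((n + 2 * i) choose n) * real ((2 * i) choose i)"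
proof -
  have "fact n * pochhammer (real n + 1) (2 * i) = fact (n + 2 * i)"
    using pochhammer_product'[of "1 :: real" n "2 * i"] by (simp add: pochhammer_fact add.commute)
  then have "pochhammer (real n + 1) (2 * i) = fact (n + 2 * i) / fact n"
    by (simp add: nonzero_eq_divide_eq mult.commute)
  then show ?thesis
    by (simp add: binomial_fact power2_eq_square)
qed

lemma op_321_closed_form:
  assumes "k \<ge> 2" "n \<ge> 1"
  shows "real (op_321 n k) = poly (P_poly k) (real n) * 2 ^ n + (-1) ^ (k - 1) * real k"
proof -
  define K where "K = k - 2"
  have k: "k = Suc (Suc K)" using assms(1) by (simp add: K_def)
  let ?f = "\<lambda>m. (-1) ^ (k + m) * real (k choose m) * real (card (avoiding_words n {..<m}))"
  let ?s = "\<lambda>j. (-1) ^ (k - j) * real (k choose (j + 2)) * 2 ^ n"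
  let ?t = "\<lambda>i j. real ((n + 2 * i) choose n) * inv_sqrt_coeff i
        * real (2 * (j - i) + 1) * inv_sqrt_coeff (j - i) / real (j + 1)"
  let ?p = "\<lambda>i. pochhammer (real n + 1) (2 * i) / (fact i)\<^sup>2"
  let ?q = "\<lambda>i j. (-1) ^ (k - j) * (1 / 2 ^ (2 * j)) * real (k choose (j + 2))
           * (real (2 * (j - i) + 1) / real (j + 1)) * real ((2 * (j - i)) choose (j - i))"
  \<comment> \<open>There is no word of length \<open>n \<ge> 1\<close> over the empty alphabet, and exactly one over a single letter.\<close>
  have f0: "?f 0 = 0"
    using assms(2) by (auto simp: avoiding_words_def)
  have f1: "?f 1 = (-1) ^ (k - 1) * real k"
    using card_avoiding_words_eq_completions[of n 0] by (simp add: completions_0_0 k)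
  have f2: "?f (j + 2) = (\<Sum>i=0..j. ?s j * ?t i j)" if "j \<le> K" for j
  proof -
    have "(-1 :: real) ^ (k + (j + 2)) = (-1) ^ (k - j)"
      using that by (auto simp: k minus_one_power_iff)
    then show ?thesis
      by (simp only: card_avoiding_words_closed_form sum_distrib_left sum_divide_distrib
          times_divide_eq_right mult_ac)
  qed
  have term_eq: "?s j * ?t i j = ?p i * ?q i j * 2 ^ n" if "i \<le> j" for i j
  proof -
    have "(4 :: real) ^ j = 4 ^ i * 4 ^ (j - i)" using that by (simp flip: power_add)
    then show ?thesis
      unfolding pochhammer_div_fact_square inv_sqrt_coeff_def by (simp add: power_mult)
  qed
  have "real (op_321 n k) = (\<Sum>m\<le>Suc (Suc K). ?f m)"
    unfolding op_321_eq_card_words card_surjective_avoiding_words k ..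
  also have "\<dots> = ?f 0 + (?f 1 + (\<Sum>j\<le>K. ?f (j + 2)))"
    by (simp only: sum.atMost_Suc_shift One_nat_def add_2_eq_Suc')
  also have "\<dots> = (\<Sum>j\<le>K. ?f (j + 2)) + (-1) ^ (k - 1) * real k"
    unfolding f0 f1 by (simp only: add_0_left add.commute)
  also have "(\<Sum>j\<le>K. ?f (j + 2)) = (\<Sum>j\<le>K. \<Sum>i | i \<in> {..K} \<and> i \<le> j. ?p i * ?q i j * 2 ^ n)"
    by (intro sum.cong refl trans[OF f2] term_eq) auto
  also have "\<dots> = (\<Sum>i\<le>K. \<Sum>j | j \<in> {..K} \<and> i \<le> j. ?p i * ?q i j * 2 ^ n)"
    by (rule sum.swap_restrict) simp_all
  also have "\<dots> = (\<Sum>i=0..K. \<Sum>j=i..K. ?p i * ?q i j * 2 ^ n)"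
    by (intro sum.cong) auto
  also have "\<dots> = poly (P_poly k) (real n) * 2 ^ n"
    unfolding poly_P_poly K_def[symmetric] by (simp only: sum_distrib_left sum_distrib_right)
  finally show ?thesis .
qed

lemma degree_pochhammer_linear:
  "degree (pochhammer [:a, 1:] m :: 'a::idom poly) = m \<and> pochhammer [:a, 1:] m \<noteq> 0"
proof (induction m)
  case (Suc m)
  define q where "q = [:a + of_nat m, 1:]"
  have "pochhammer [:a, 1:] (Suc m) = pochhammer [:a, 1:] m * q"
    by (simp only: pochhammer_Suc q_def of_nat_poly) simp
  moreover have "degree q = 1" "q \<noteq> 0" by (simp_all add: q_def)
  ultimately show ?case
    using Suc degree_mult_eq[of "pochhammer [:a, 1:] m" q] by simp
qed simp

lemma degree_P_poly:
  assumes "k \<ge> 2"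
  shows "degree (P_poly k) = 2 * k - 4"
proof -
  define K where "K = k - 2"
  have k: "k = Suc (Suc K)" using assms by (simp add: K_def)
  define a where "a i = 1 / (fact i)\<^sup>2 *
         (\<Sum>j=i..K. (-1) ^ (k - j) * (1 / 2 ^ (2 * j)) * real (k choose (j + 2))
            * (real (2 * (j - i) + 1) / real (j + 1)) * real ((2 * (j - i)) choose (j - i)))" for i
  let ?p = "\<lambda>i. smult (a i) (pochhammer [:1, 1:] (2 * i))"
  \<comment> \<open>The inner sum for \<open>i = K\<close> has the single term \<open>j = K\<close>, where \<open>k choose (j + 2) = 1\<close>.\<close>
  have "a K \<noteq> 0" by (simp add: a_def k)
  then have top: "degree (?p K) = 2 * K"
    using degree_pochhammer_linear[of "1 :: real"] by simp
  have "P_poly k = (\<Sum>i=0..K. ?p i)"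
    by (simp only: P_poly_def a_def K_def)
  also have "\<dots> = (\<Sum>i<K. ?p i) + ?p K"
    by (simp add: atLeast0AtMost flip: lessThan_Suc_atMost)
  finally have split: "P_poly k = (\<Sum>i<K. ?p i) + ?p K" .
  show ?thesis
  proof (cases "K = 0")
    case False
    have "degree (\<Sum>i<K. ?p i) < 2 * K"
      using False degree_pochhammer_linear[of "1 :: real"]
      by (intro degree_sum_less) (auto intro: le_less_trans[OF degree_smult_le])
    then show ?thesis
      unfolding split using top by (simp add: degree_add_eq_right k)
  qed (use split top in \<open>simp add: k\<close>)
qed

theorem corollary3p6:
  fixes k :: nat
  assumes "k \<ge> 2"
  shows "degree (P_poly k) = 2 * k - 4 \<and>
    (\<forall>n::nat. n \<ge> 1 \<longrightarrow>
       real (op_321 n k) = poly (P_poly k) (real n) * 2 ^ n + (-1) ^ (k - 1) * real k)"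
  using degree_P_poly[OF assms] op_321_closed_form[OF assms] by blast

end
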